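(* Let $Q=(Q,\cdot)$ be a quasigroup with parastrophes $Q_1,\dots,Q_5$. The number of non-isotopic parastrophes of $Q$, i.e. the number of equivalence classes of $\{Q,Q_1,Q_2,Q_3,Q_4,Q_5\}$ under the isotopy relation $\approx$, is always $1$, $2$, $3$ or $6$.
   Context: $S_Q$ is the set of all permutations of the set $Q$. Quasigroups $(Q,\cdot)$ and $(Q,\circ)$ on the same set are isotopic, written $(Q,\cdot)\approx(Q,\circ)$, if there are $\alpha,\beta,\gamma\in S_Q$ with $\alpha(x)\circ\beta(y)=\gamma(x\cdot y)$ for all $x,y\in Q$; this is an equivalence relation. The parastrophes $Q_i=(Q,\circ_i)$, $i=1,\dots,5$, of a quasigroup $(Q,\cdot)$ are defined by: $x\circ_1 y=z\iff x\cdot z=y$; $x\circ_2 y=z\iff z\cdot y=x$; $x\circ_3 y=z\iff z\cdot x=y$; $x\circ_4 y=z\iff y\cdot z=x$; $x\circ_5 y=z\iff y\cdot x=z$. *)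

theory Defs
  imports "HOL-Combinatorics.Permutations"
begin

locale quasigroup =
  fixes Q :: "'a set" and mul :: "'a \<Rightarrow> 'a \<Rightarrow> 'a"
  assumes closed: "x \<in> Q \<Longrightarrow> y \<in> Q \<Longrightarrow> mul x y \<in> Q"
    and left_div: "x \<in> Q \<Longrightarrow> y \<in> Q \<Longrightarrow> \<exists>!z. z \<in> Q \<and> mul x z = y"
    and right_div: "x \<in> Q \<Longrightarrow> y \<in> Q \<Longrightarrow> \<exists>!z. z \<in> Q \<and> mul z x = y"

text \<open>
  Operations are total functions, but only their values on \<open>Q\<close> matter: isotopy ignores the
  others, and the descriptions below are used for arguments in \<open>Q\<close> only.
\<close>

definition isotopic :: "'a set \<Rightarrow> ('a \<Rightarrow> 'a \<Rightarrow> 'a) \<Rightarrow> ('a \<Rightarrow> 'a \<Rightarrow> 'a) \<Rightarrow> bool" where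
  "isotopic Q f g \<longleftrightarrow> (\<exists>\<alpha> \<beta> \<gamma>. \<alpha> permutes Q \<and> \<beta> permutes Q \<and> \<gamma> permutes Q \<and>
     (\<forall>x\<in>Q. \<forall>y\<in>Q. g (\<alpha> x) (\<beta> y) = \<gamma> (f x y)))"

definition parastrophe1 :: "'a set \<Rightarrow> ('a \<Rightarrow> 'a \<Rightarrow> 'a) \<Rightarrow> 'a \<Rightarrow> 'a \<Rightarrow> 'a" where
  "parastrophe1 Q f x y = (THE z. z \<in> Q \<and> f x z = y)"

definition parastrophe2 :: "'a set \<Rightarrow> ('a \<Rightarrow> 'a \<Rightarrow> 'a) \<Rightarrow> 'a \<Rightarrow> 'a \<Rightarrow> 'a" where
  "parastrophe2 Q f x y = (THE z. z \<in> Q \<and> f z y = x)"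

definition parastrophe3 :: "'a set \<Rightarrow> ('a \<Rightarrow> 'a \<Rightarrow> 'a) \<Rightarrow> 'a \<Rightarrow> 'a \<Rightarrow> 'a" where
  "parastrophe3 Q f x y = (THE z. z \<in> Q \<and> f z x = y)"

definition parastrophe4 :: "'a set \<Rightarrow> ('a \<Rightarrow> 'a \<Rightarrow> 'a) \<Rightarrow> 'a \<Rightarrow> 'a \<Rightarrow> 'a" where
  "parastrophe4 Q f x y = (THE z. z \<in> Q \<and> f y z = x)"

definition parastrophe5 :: "'a set \<Rightarrow> ('a \<Rightarrow> 'a \<Rightarrow> 'a) \<Rightarrow> 'a \<Rightarrow> 'a \<Rightarrow> 'a" where
  "parastrophe5 Q f x y = (THE z. z \<in> Q \<and> f y x = z)"

definition parastrophes :: "'a set \<Rightarrow> ('a \<Rightarrow> 'a \<Rightarrow> 'a) \<Rightarrow> ('a \<Rightarrow> 'a \<Rightarrow> 'a) set" where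
  "parastrophes Q f = {f, parastrophe1 Q f, parastrophe2 Q f, parastrophe3 Q f,
     parastrophe4 Q f, parastrophe5 Q f}"

definition isotopy_rel :: "'a set \<Rightarrow> ('a \<Rightarrow> 'a \<Rightarrow> 'a) set \<Rightarrow> (('a \<Rightarrow> 'a \<Rightarrow> 'a) \<times> ('a \<Rightarrow> 'a \<Rightarrow> 'a)) set" where
  "isotopy_rel Q F = {(g, h). g \<in> F \<and> h \<in> F \<and> isotopic Q g h}"

context quasigroup
begin

lemma parastrophe_iff:
  assumes "x \<in> Q" "y \<in> Q" "z \<in> Q"
  shows "parastrophe1 Q mul x y = z \<longleftrightarrow> mul x z = y"
    and "parastrophe2 Q mul x y = z \<longleftrightarrow> mul z y = x"
    and "parastrophe3 Q mul x y = z \<longleftrightarrow> mul z x = y"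
    and "parastrophe4 Q mul x y = z \<longleftrightarrow> mul y z = x"
    and "parastrophe5 Q mul x y = z \<longleftrightarrow> mul y x = z"
proof -
  have the_iff: "(THE z. z \<in> Q \<and> P z) = z \<longleftrightarrow> P z" if "\<exists>!z. z \<in> Q \<and> P z" for P
    using theI'[OF that] the1_equality[OF that] assms(3) by blast
  show "parastrophe1 Q mul x y = z \<longleftrightarrow> mul x z = y"
    unfolding parastrophe1_def by (rule the_iff[OF left_div[OF assms(1,2)]])
  show "parastrophe2 Q mul x y = z \<longleftrightarrow> mul z y = x"
    unfolding parastrophe2_def by (rule the_iff[OF right_div[OF assms(2,1)]])
  show "parastrophe3 Q mul x y = z \<longleftrightarrow> mul z x = y"
    unfolding parastrophe3_def by (rule the_iff[OF right_div[OF assms(1,2)]])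
  show "parastrophe4 Q mul x y = z \<longleftrightarrow> mul y z = x"
    unfolding parastrophe4_def by (rule the_iff[OF left_div[OF assms(2,1)]])
  show "parastrophe5 Q mul x y = z \<longleftrightarrow> mul y x = z"
    unfolding parastrophe5_def by (rule the_iff) (use closed[OF assms(2,1)] in blast)
qed

lemma parastrophe_closed:
  assumes "x \<in> Q" "y \<in> Q" "g \<in> parastrophes Q mul"
  shows "g x y \<in> Q"
proof -
  have the_in: "(THE z. z \<in> Q \<and> P z) \<in> Q" if "\<exists>!z. z \<in> Q \<and> P z" for P
    using theI'[OF that] by blast
  have "parastrophe5 Q mul x y \<in> Q"
    unfolding parastrophe5_def by (rule the_in) (use closed[OF assms(2,1)] in blast)
  with assms closed the_in[OF left_div] the_in[OF right_div] show ?thesis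
    unfolding parastrophes_def
    by (auto simp: parastrophe1_def parastrophe2_def parastrophe3_def parastrophe4_def)
qed

lemma equiv_isotopy_rel: "equiv (parastrophes Q mul) (isotopy_rel Q (parastrophes Q mul))"
proof (rule equivI)
  have "isotopic Q f f" for f
    unfolding isotopic_def by (intro exI[of _ id]) (simp add: permutes_id)
  then show "refl_on (parastrophes Q mul) (isotopy_rel Q (parastrophes Q mul))"
    unfolding refl_on_def isotopy_rel_def by auto
  show "isotopy_rel Q (parastrophes Q mul) \<subseteq> parastrophes Q mul \<times> parastrophes Q mul"
    unfolding isotopy_rel_def by auto
  have "isotopic Q g f" if iso: "isotopic Q f g" for f g
  proof -
    obtain a b c where p: "a permutes Q" "b permutes Q" "c permutes Q"
      and eq: "\<forall>x\<in>Q. \<forall>y\<in>Q. g (a x) (b y) = c (f x y)"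
      using iso unfolding isotopic_def by auto
    have "f (inv a x) (inv b y) = inv c (g x y)" if xy: "x \<in> Q" "y \<in> Q" for x y
    proof -
      have "inv a x \<in> Q" "inv b y \<in> Q"
        using xy permutes_in_image[OF permutes_inv[OF p(1)]]
          permutes_in_image[OF permutes_inv[OF p(2)]] by simp_all
      then have "g (a (inv a x)) (b (inv b y)) = c (f (inv a x) (inv b y))"
        using eq by blast
      then show ?thesis
        by (simp add: permutes_inverses[OF p(1)] permutes_inverses[OF p(2)]
            permutes_inverses[OF p(3)])
    qed
    then show ?thesis
      unfolding isotopic_def using p[THEN permutes_inv] by blast
  qed
  then show "sym (isotopy_rel Q (parastrophes Q mul))"
    unfolding sym_def isotopy_rel_def by auto
  have "isotopic Q f h" if iso: "isotopic Q f g" "isotopic Q g h" for f g h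
  proof -
    obtain a b c where p: "a permutes Q" "b permutes Q" "c permutes Q"
      and eq: "\<forall>x\<in>Q. \<forall>y\<in>Q. g (a x) (b y) = c (f x y)"
      using iso(1) unfolding isotopic_def by auto
    obtain a' b' c' where p': "a' permutes Q" "b' permutes Q" "c' permutes Q"
      and eq': "\<forall>x\<in>Q. \<forall>y\<in>Q. h (a' x) (b' y) = c' (g x y)"
      using iso(2) unfolding isotopic_def by auto
    have "\<forall>x\<in>Q. \<forall>y\<in>Q. h ((a' \<circ> a) x) ((b' \<circ> b) y) = (c' \<circ> c) (f x y)"
      using eq eq' permutes_in_image[OF p(1)] permutes_in_image[OF p(2)] by simp
    then show ?thesis
      unfolding isotopic_def
      using permutes_compose[OF p(1) p'(1)] permutes_compose[OF p(2) p'(2)]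
        permutes_compose[OF p(3) p'(3)] by blast
  qed
  then show "trans (isotopy_rel Q (parastrophes Q mul))"
    unfolding trans_def isotopy_rel_def by auto
qed

end

end

theory Submission
  imports Defs
begin

text \<open>
  On \<open>Q\<close>, the left and the right division of any parastrophe are again parastrophes, so these two
  operations permute the six (indexed) parastrophes. An isotopy of two operations is also an isotopy
  of their left (right) divisions, with two of its components interchanged. As the action on the
  indices is transitive, all isotopy classes contain equally many of the six indices, hence their
  number divides 6.
\<close>

text \<open>The nonempty fibres of \<open>F\<close> partition \<open>A\<close>, one for each value.
  When all have the same size, \<open>card A\<close> is that size times the number of
  values.\<close>

lemma card_image_dvd:
  assumes fin: "finite A"
    and eq: "\<And>i j. i \<in> A \<Longrightarrow> j \<in> A \<Longrightarrow> card {k \<in> A. F k = F i} = card {k \<in> A. F k = F j}"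
  shows "card (F ` A) dvd card A"
proof (cases "A = {}")
  case False
  then obtain i where i: "i \<in> A" by blast
  have "card A = (\<Sum>y\<in>F ` A. card {k \<in> A. F k = y})"
    using sum.image_gen[OF fin, of "\<lambda>_. 1::nat" F] by simp
  also have "\<dots> = (\<Sum>y\<in>F ` A. card {k \<in> A. F k = F i})"
    using eq[OF _ i] by (intro sum.cong) auto
  finally show ?thesis by simp
qed simp

text \<open>Since \<open>s\<close> respects equality of \<open>F\<close>-values, it maps the fibre
  through \<open>i\<close> injectively into the fibre through \<open>s i\<close>. When
  \<open>s\<close> is an involution, using this at \<open>i\<close> and at \<open>s i\<close> gives
  equality.\<close>

lemma card_fibre_le:
  assumes "finite A" "inj_on s A" "s ` A \<subseteq> A" "i \<in> A"
    and "\<And>k l. k \<in> A \<Longrightarrow> l \<in> A \<Longrightarrow> F k = F l \<Longrightarrow> F (s k) = F (s l)"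
  shows "card {k \<in> A. F k = F i} \<le> card {k \<in> A. F k = F (s i)}"
proof (rule card_inj_on_le)
  show "inj_on s {k \<in> A. F k = F i}"
    by (rule inj_on_subset[OF assms(2)]) blast
  show "s ` {k \<in> A. F k = F i} \<subseteq> {k \<in> A. F k = F (s i)}"
    using assms(3) assms(5)[OF _ assms(4)] by blast
qed (simp add: assms(1))

text \<open>This form treats the two arguments and the result alike: \<open>(a, b, c)\<close>
  carries the graph of \<open>f\<close> to that of \<open>g\<close>, so passing to a division only
  permutes coordinates. One direction takes \<open>z\<close> to be \<open>f x y\<close>, the other
  uses that \<open>c\<close> is injective.\<close>

lemma isotopic_iff_graph:
  assumes "\<And>x y. x \<in> Q \<Longrightarrow> y \<in> Q \<Longrightarrow> f x y \<in> Q"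
  shows "isotopic Q f g \<longleftrightarrow> (\<exists>a b c. a permutes Q \<and> b permutes Q \<and> c permutes Q \<and>
    (\<forall>x\<in>Q. \<forall>y\<in>Q. \<forall>z\<in>Q. f x y = z \<longleftrightarrow> g (a x) (b y) = c z))"
proof -
  have "(\<forall>x\<in>Q. \<forall>y\<in>Q. g (a x) (b y) = c (f x y)) \<longleftrightarrow>
    (\<forall>x\<in>Q. \<forall>y\<in>Q. \<forall>z\<in>Q. f x y = z \<longleftrightarrow> g (a x) (b y) = c z)" if "c permutes Q" for a b c
  proof (intro ball_cong refl)
    fix x y assume "x \<in> Q" "y \<in> Q"
    then have "f x y \<in> Q" by (rule assms)
    then show "g (a x) (b y) = c (f x y) \<longleftrightarrow> (\<forall>z\<in>Q. f x y = z \<longleftrightarrow> g (a x) (b y) = c z)"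
      using permutes_inj[OF that, THEN inj_eq] by metis
  qed
  then show ?thesis unfolding isotopic_def by blast
qed

lemma isotopic_left_division:
  assumes "isotopic Q f g"
    and "\<And>x y. x \<in> Q \<Longrightarrow> y \<in> Q \<Longrightarrow> f x y \<in> Q" "\<And>x y. x \<in> Q \<Longrightarrow> y \<in> Q \<Longrightarrow> f' x y \<in> Q"
    and f': "\<And>x y z. x \<in> Q \<Longrightarrow> y \<in> Q \<Longrightarrow> z \<in> Q \<Longrightarrow> f' x y = z \<longleftrightarrow> f x z = y"
    and g': "\<And>x y z. x \<in> Q \<Longrightarrow> y \<in> Q \<Longrightarrow> z \<in> Q \<Longrightarrow> g' x y = z \<longleftrightarrow> g x z = y"
  shows "isotopic Q f' g'"
proof -
  obtain a b c where p: "a permutes Q" "b permutes Q" "c permutes Q"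
    and eq: "\<forall>x\<in>Q. \<forall>y\<in>Q. \<forall>z\<in>Q. f x y = z \<longleftrightarrow> g (a x) (b y) = c z"
    using assms(1) isotopic_iff_graph[of Q f g, OF assms(2)] by auto
  \<comment> \<open>Left division swaps the second and third coordinates of the graph, so
    \<open>b\<close> and \<open>c\<close> trade places.\<close>
  have "\<forall>x\<in>Q. \<forall>y\<in>Q. \<forall>z\<in>Q. f' x y = z \<longleftrightarrow> g' (a x) (c y) = b z"
    using eq by (simp add: f' g' p[THEN permutes_in_image])
  then show ?thesis
    using p isotopic_iff_graph[of Q f' g', OF assms(3)] by blast
qed

lemma isotopic_right_division:
  assumes "isotopic Q f g"
    and "\<And>x y. x \<in> Q \<Longrightarrow> y \<in> Q \<Longrightarrow> f x y \<in> Q" "\<And>x y. x \<in> Q \<Longrightarrow> y \<in> Q \<Longrightarrow> f' x y \<in> Q"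
    and f': "\<And>x y z. x \<in> Q \<Longrightarrow> y \<in> Q \<Longrightarrow> z \<in> Q \<Longrightarrow> f' x y = z \<longleftrightarrow> f z y = x"
    and g': "\<And>x y z. x \<in> Q \<Longrightarrow> y \<in> Q \<Longrightarrow> z \<in> Q \<Longrightarrow> g' x y = z \<longleftrightarrow> g z y = x"
  shows "isotopic Q f' g'"
proof -
  obtain a b c where p: "a permutes Q" "b permutes Q" "c permutes Q"
    and eq: "\<forall>x\<in>Q. \<forall>y\<in>Q. \<forall>z\<in>Q. f x y = z \<longleftrightarrow> g (a x) (b y) = c z"
    using assms(1) isotopic_iff_graph[of Q f g, OF assms(2)] by auto
  \<comment> \<open>Right division swaps the first and third coordinates, so here \<open>a\<close>
    and \<open>c\<close> trade places.\<close>
  have "\<forall>x\<in>Q. \<forall>y\<in>Q. \<forall>z\<in>Q. f' x y = z \<longleftrightarrow> g' (c x) (b y) = a z"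
    using eq by (simp add: f' g' p[THEN permutes_in_image])
  then show ?thesis
    using p isotopic_iff_graph[of Q f' g', OF assms(3)] by blast
qed

text \<open>Indices are counted instead of operations because several parastrophes may coincide as
  functions; with indices there are always exactly six objects to distribute among the
  classes.\<close>

definition parastrophe :: "'a set \<Rightarrow> ('a \<Rightarrow> 'a \<Rightarrow> 'a) \<Rightarrow> nat \<Rightarrow> 'a \<Rightarrow> 'a \<Rightarrow> 'a" where
  "parastrophe Q f i = [f, parastrophe1 Q f, parastrophe2 Q f, parastrophe3 Q f,
     parastrophe4 Q f, parastrophe5 Q f] ! i"

text \<open>The index, on \<open>Q\<close>, of the left and of the right division of the parastrophe with index \<open>i\<close>.\<close>

definition left_index :: "nat \<Rightarrow> nat" where
  "left_index i = [1, 0, 4, 5, 2, 3] ! i"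

definition right_index :: "nat \<Rightarrow> nat" where
  "right_index i = [2, 3, 0, 1, 5, 4] ! i"

lemma lessThan_6: "{..<6} = {0, 1, 2, 3, 4, 5::nat}"
  by auto

lemma parastrophes_eq_image: "parastrophes Q f = parastrophe Q f ` {..<6}"
  unfolding lessThan_6 parastrophes_def by (simp add: parastrophe_def)

lemma index_permutes:
  "inj_on left_index {..<6}" "left_index ` {..<6} \<subseteq> {..<6}"
  "inj_on right_index {..<6}" "right_index ` {..<6} \<subseteq> {..<6}"
  unfolding lessThan_6 by (simp_all add: left_index_def right_index_def)

context quasigroup
begin

text \<open>For each of the six indices, \<open>parastrophe_iff\<close> turns both sides into the
  same equation in \<open>mul\<close>.\<close>

lemma parastrophe_left_index:
  assumes "i \<in> {..<6}" "x \<in> Q" "y \<in> Q" "z \<in> Q"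
  shows "parastrophe Q mul (left_index i) x y = z \<longleftrightarrow> parastrophe Q mul i x z = y"
  using assms(1) unfolding lessThan_6
  by (elim insertE emptyE) (simp_all add: parastrophe_def left_index_def parastrophe_iff assms(2-))

lemma parastrophe_right_index:
  assumes "i \<in> {..<6}" "x \<in> Q" "y \<in> Q" "z \<in> Q"
  shows "parastrophe Q mul (right_index i) x y = z \<longleftrightarrow> parastrophe Q mul i z y = x"
  using assms(1) unfolding lessThan_6
  by (elim insertE emptyE) (simp_all add: parastrophe_def right_index_def parastrophe_iff assms(2-))

lemma card_isotopy_classes_dvd_6:
  "card (parastrophes Q mul // isotopy_rel Q (parastrophes Q mul)) dvd 6"
proof -
  define A where "A = {..<6::nat}"
  define P where "P = parastrophe Q mul"
  \<comment> \<open>\<open>F\<close> sends an index to its isotopy class and \<open>N\<close> counts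
    the indices sharing that class, so the goal becomes that \<open>N\<close> is constant on
    \<open>A\<close>.\<close>
  define F where "F i = isotopy_rel Q (parastrophes Q mul) `` {P i}" for i
  define N where "N i = card {k \<in> A. F k = F i}" for i
  have P_in: "P i \<in> parastrophes Q mul" if "i \<in> A" for i
    using that unfolding A_def P_def parastrophes_eq_image by blast
  have F_eq: "F i = F j \<longleftrightarrow> isotopic Q (P i) (P j)" if "i \<in> A" "j \<in> A" for i j
    using eq_equiv_class_iff[OF equiv_isotopy_rel P_in[OF that(1)] P_in[OF that(2)]]
      P_in[OF that(1)] P_in[OF that(2)]
    by (simp add: F_def isotopy_rel_def)
  have closed': "P i x y \<in> Q" if "i \<in> A" "x \<in> Q" "y \<in> Q" for i x y
    using parastrophe_closed[OF that(2,3) P_in[OF that(1)]] .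
  have left_A: "left_index i \<in> A" and right_A: "right_index i \<in> A" if "i \<in> A" for i
    using index_permutes that unfolding A_def by blast+
  have left: "F (left_index k) = F (left_index l)" if kl: "k \<in> A" "l \<in> A" "F k = F l" for k l
  proof -
    have "isotopic Q (P k) (P l)" using kl F_eq by blast
    then have "isotopic Q (P (left_index k)) (P (left_index l))"
      by (rule isotopic_left_division)
        (use kl in \<open>auto simp: closed' left_A parastrophe_left_index[folded A_def P_def]\<close>)
    then show ?thesis using F_eq left_A kl by blast
  qed
  have right: "F (right_index k) = F (right_index l)" if kl: "k \<in> A" "l \<in> A" "F k = F l" for k l
  proof -
    have "isotopic Q (P k) (P l)" using kl F_eq by blast
    then have "isotopic Q (P (right_index k)) (P (right_index l))"
      by (rule isotopic_right_division)
        (use kl in \<open>auto simp: closed' right_A parastrophe_right_index[folded A_def P_def]\<close>)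
    then show ?thesis using F_eq right_A kl by blast
  qed
  have fin: "finite A" by (simp add: A_def)
  have N_left: "N i \<le> N (left_index i)" if "i \<in> A" for i
    unfolding N_def
    by (rule card_fibre_le[OF fin index_permutes(1,2)[folded A_def] that]) (rule left)
  have N_right: "N i \<le> N (right_index i)" if "i \<in> A" for i
    unfolding N_def
    by (rule card_fibre_le[OF fin index_permutes(3,4)[folded A_def] that]) (rule right)
  \<comment> \<open>Both index maps are involutions, so the inequalities hold in both directions.
    The pairs 0-1, 2-4, 3-5 come from \<open>left_index\<close> and 0-2, 1-3 from
    \<open>right_index\<close>; together they connect all six indices.\<close>
  have "N 0 = N 1" "N 2 = N 4" "N 3 = N 5" "N 0 = N 2" "N 1 = N 3"
    using N_left[of 0] N_left[of 1] N_left[of 2] N_left[of 4] N_left[of 3] N_left[of 5]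
      N_right[of 0] N_right[of 2] N_right[of 1] N_right[of 3]
    by (simp_all add: A_def left_index_def right_index_def)
  then have "N i = N 0" if "i \<in> A" for i
    using that unfolding A_def lessThan_6 by auto
  then have "card (F ` A) dvd card A"
    by (intro card_image_dvd[OF fin]) (simp add: N_def)
  \<comment> \<open>Every parastrophe has an index, and one with several indices yields the same
    class each time.\<close>
  moreover have "parastrophes Q mul // isotopy_rel Q (parastrophes Q mul) = F ` A"
    unfolding quotient_def F_def A_def P_def parastrophes_eq_image by blast
  ultimately show ?thesis by (simp add: A_def)
qed

end

theorem corollary2p14:
  fixes Q :: "'a set" and mul :: "'a \<Rightarrow> 'a \<Rightarrow> 'a"
  assumes "quasigroup Q mul"
  shows "card (parastrophes Q mul // isotopy_rel Q (parastrophes Q mul)) \<in> {1, 2, 3, 6}"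
proof -
  have "n \<in> {1, 2, 3, 6}" if n: "n dvd 6" for n :: nat
  proof -
    have "n \<le> 6" using n by (rule dvd_imp_le) simp
    \<comment> \<open>Of these candidates, 0, 4 and 5 do not divide 6.\<close>
    then have "n \<in> {0, 1, 2, 3, 4, 5, 6}" by auto
    then show ?thesis using n by auto
  qed
  then show ?thesis
    using quasigroup.card_isotopy_classes_dvd_6[OF assms] .
qed

end
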